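(* Let the nonlinear system $z_{t+1}=f(z_t,u_t)$, initialized at $z_1$, have Koopman embedding $(A,B,C,\psi)$, and let the lifted linear system $x_{t+1}=Ax_t+Bu_t$ be initialized at $x_1=\psi(z_1)$. Then for any online policy $\pi$, $\mathrm{Reg}_T(\pi)=\mathrm{Reg}_T^{\mathrm{lft}}(\pi)$.
   Context: States $z_t\in\mathbb{R}^{n_z}$, inputs $u_t\in\mathbb{R}^{n_u}$, target trajectory $\mathbf r=r_{1:T}$ with $r_t\in\mathbb{R}^{n_z}$, $\|r_t\|\le1$, weights $Q_z\succeq0$, $R\succ0$; $\|x\|_P^2:=x^{\top}Px$ for $P\succeq 0$. The system $f$ has Koopman embedding $(A,B,C,\psi)$ if $\psi:\mathbb{R}^{n_z}\to\mathbb{R}^{n_x}$ and matrices $A\in\mathbb{R}^{n_x\times n_x}$, $B\in\mathbb{R}^{n_x\times n_u}$, $C\in\mathbb{R}^{n_z\times n_x}$ satisfy $\psi(f(z,u))=A\psi(z)+Bu$ and $z=C\psi(z)$ for all $z,u$. An online (causal) policy with prediction horizon $W$ is $\pi=\{\pi_t\}_{t=1}^T$ with $u_t=\pi_t(z_{1:t},r_{1:t+W-1})$. Let $\mathbf u=u_{1:T}$ be the control sequence it generates. $J_T(\mathbf u;\mathbf r)=\sum_{t=1}^T\big(\|z_t-r_t\|_{Q_z}^2+\|u_t\|_R^2\big)$ along $z_{t+1}=f(z_t,u_t)$, $J_T^*=\min_{\mathbf u}J_T(\mathbf u;\mathbf r)$, and $\mathrm{Reg}_T(\pi)=J_T(\mathbf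 u;\mathbf r)-J_T^*$. With $Q:=C^{\top}Q_zC$, $J_T^{\mathrm{lft}}(\mathbf u;\mathbf r)=\sum_{t=1}^T\big(\|x_t-\psi(r_t)\|_{Q}^2+\|u_t\|_R^2\big)$ along $x_{t+1}=Ax_t+Bu_t$, $(J_T^{\mathrm{lft}})^*=\min_{\mathbf u}J_T^{\mathrm{lft}}(\mathbf u;\mathbf r)$, and $\mathrm{Reg}_T^{\mathrm{lft}}(\pi)=J_T^{\mathrm{lft}}(\mathbf u;\mathbf r)-(J_T^{\mathrm{lft}})^*$. *)

theory Defs
  imports "HOL-Analysis.Analysis"
begin

text \<open>Time starts at 1. Sequences are functions on \<^typ>\<open>nat\<close> whose value at 0 is never used.\<close>

definition psd :: "real^'n^'n \<Rightarrow> bool" where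
  "psd P \<longleftrightarrow> transpose P = P \<and> (\<forall>x. 0 \<le> x \<bullet> (P *v x))"

definition posdef :: "real^'n^'n \<Rightarrow> bool" where
  "posdef P \<longleftrightarrow> transpose P = P \<and> (\<forall>x. x \<noteq> 0 \<longrightarrow> 0 < x \<bullet> (P *v x))"

definition sqnorm_wrt :: "real^'n^'n \<Rightarrow> real^'n \<Rightarrow> real" where
  "sqnorm_wrt P x = x \<bullet> (P *v x)"

definition koopman_embedding ::
  "(real^'nz \<Rightarrow> real^'nu \<Rightarrow> real^'nz) \<Rightarrow> real^'nx^'nx \<Rightarrow> real^'nu^'nx \<Rightarrow> real^'nx^'nz
    \<Rightarrow> (real^'nz \<Rightarrow> real^'nx) \<Rightarrow> bool" where
  "koopman_embedding f A B C \<psi> \<longleftrightarrow>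
     (\<forall>z u. \<psi> (f z u) = A *v \<psi> z + B *v u \<and> z = C *v \<psi> z)"

definition linear_system ::
  "real^'nx^'nx \<Rightarrow> real^'nu^'nx \<Rightarrow> real^'nx \<Rightarrow> real^'nu \<Rightarrow> real^'nx" where
  "linear_system A B x u = A *v x + B *v u"

text \<open>The state trajectory of \<open>x\<^sub>t\<^sub>+\<^sub>1 = F x\<^sub>t u\<^sub>t\<close> (for \<open>t \<ge> 1\<close>) with state \<open>x1\<close> at time 1.\<close>

primrec trajectory :: "('x \<Rightarrow> 'u \<Rightarrow> 'x) \<Rightarrow> 'x \<Rightarrow> (nat \<Rightarrow> 'u) \<Rightarrow> nat \<Rightarrow> 'x" where
  "trajectory F x1 u 0 = x1"
| "trajectory F x1 u (Suc t) = (if t = 0 then x1 else F (trajectory F x1 u t) (u t))"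

lemma trajectory_first: "trajectory F x1 u 1 = x1"
  by simp

lemma trajectory_step:
  "1 \<le> t \<Longrightarrow> trajectory F x1 u (t + 1) = F (trajectory F x1 u t) (u t)"
  by simp

definition tracking_cost ::
  "(real^'n \<Rightarrow> real^'nu \<Rightarrow> real^'n) \<Rightarrow> real^'n^'n \<Rightarrow> real^'nu^'nu \<Rightarrow> real^'n
    \<Rightarrow> (nat \<Rightarrow> real^'n) \<Rightarrow> nat \<Rightarrow> (nat \<Rightarrow> real^'nu) \<Rightarrow> real" where
  "tracking_cost F P R x1 g T u =
     (\<Sum>t = 1..T. sqnorm_wrt P (trajectory F x1 u t - g t) + sqnorm_wrt R (u t))"

text \<open>The minimal cost over all control sequences, expressed as an infimum;
  it is attained, see \<open>tracking_cost_min_attained\<close> and \<open>lifted_cost_min_attained\<close> below.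
  The cost depends on \<open>u\<close> only through \<open>u\<^sub>1, \<dots>, u\<^sub>T\<close>.\<close>

definition optimal_cost ::
  "(real^'n \<Rightarrow> real^'nu \<Rightarrow> real^'n) \<Rightarrow> real^'n^'n \<Rightarrow> real^'nu^'nu \<Rightarrow> real^'n
    \<Rightarrow> (nat \<Rightarrow> real^'n) \<Rightarrow> nat \<Rightarrow> real" where
  "optimal_cost F P R x1 g T = (INF u. tracking_cost F P R x1 g T u)"

text \<open>Segments \<open>z\<^sub>1\<^sub>:\<^sub>t\<close> are lists, so that a policy
  \<open>\<pi> t [z\<^sub>1, \<dots>, z\<^sub>t] [r\<^sub>1, \<dots>, r\<^sub>t\<^sub>+\<^sub>W\<^sub>-\<^sub>1]\<close> is causal by its type.\<close>

definition segment :: "(nat \<Rightarrow> 'a) \<Rightarrow> nat \<Rightarrow> 'a list" where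
  "segment s k = map s [1..<Suc k]"

type_synonym ('z, 'u) policy = "nat \<Rightarrow> 'z list \<Rightarrow> 'z list \<Rightarrow> 'u"

text \<open>The target is given up to time \<open>T\<close> only, so near the end of the horizon the preview
  window is cut off at \<open>T\<close>.\<close>

definition preview :: "(nat \<Rightarrow> 'z) \<Rightarrow> nat \<Rightarrow> nat \<Rightarrow> nat \<Rightarrow> 'z list" where
  "preview r T W t = segment r (min (t + W - 1) T)"

text \<open>The list \<open>[z\<^sub>1, \<dots>, z\<^sub>t]\<close> of closed-loop states.\<close>

primrec closed_loop_states ::
  "('z \<Rightarrow> 'u \<Rightarrow> 'z) \<Rightarrow> 'z \<Rightarrow> (nat \<Rightarrow> 'z) \<Rightarrow> nat \<Rightarrow> nat \<Rightarrow> ('z, 'u) policy \<Rightarrow> nat \<Rightarrow> 'z list" where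
  "closed_loop_states f z1 r T W \<pi> 0 = []"
| "closed_loop_states f z1 r T W \<pi> (Suc t) =
     (if t = 0 then [z1]
      else (let zs = closed_loop_states f z1 r T W \<pi> t
            in zs @ [f (last zs) (\<pi> t zs (preview r T W t))]))"

definition policy_controls ::
  "('z \<Rightarrow> 'u \<Rightarrow> 'z) \<Rightarrow> 'z \<Rightarrow> (nat \<Rightarrow> 'z) \<Rightarrow> nat \<Rightarrow> nat \<Rightarrow> ('z, 'u) policy \<Rightarrow> nat \<Rightarrow> 'u" where
  "policy_controls f z1 r T W \<pi> t =
     \<pi> t (closed_loop_states f z1 r T W \<pi> t) (preview r T W t)"

lemma closed_loop_states_eq:
  "closed_loop_states f z1 r T W \<pi> t =
     segment (trajectory f z1 (policy_controls f z1 r T W \<pi>)) t"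
proof (induction t)
  case 0
  show ?case by (simp add: segment_def)
next
  case (Suc t)
  show ?case
  proof (cases "t = 0")
    case True
    then show ?thesis by (simp add: segment_def)
  next
    case False
    then have "last (segment (trajectory f z1 (policy_controls f z1 r T W \<pi>)) t)
        = trajectory f z1 (policy_controls f z1 r T W \<pi>) t"
      by (simp add: segment_def last_map)
    moreover have "policy_controls f z1 r T W \<pi> t = 
        \<pi> t (segment (trajectory f z1 (policy_controls f z1 r T W \<pi>)) t) (preview r T W t)"
      by (metis Suc policy_controls_def)
    ultimately show ?thesis using False Suc by (simp add: Let_def) (simp add: segment_def)
  qed
qed

text \<open>The defining property \<open>u\<^sub>t = \<pi>\<^sub>t(z\<^sub>1\<^sub>:\<^sub>t, r\<^sub>1\<^sub>:\<^sub>t\<^sub>+\<^sub>W\<^sub>-\<^sub>1)\<close> along \<open>z\<^sub>t\<^sub>+\<^sub>1 = f(z\<^sub>t, u\<^sub>t)\<close>.\<close>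

lemma policy_controls_closed_loop:
  "policy_controls f z1 r T W \<pi> t =
     \<pi> t (segment (trajectory f z1 (policy_controls f z1 r T W \<pi>)) t) (preview r T W t)"
  by (metis closed_loop_states_eq policy_controls_def)

definition regret ::
  "(real^'nz \<Rightarrow> real^'nu \<Rightarrow> real^'nz) \<Rightarrow> real^'nz^'nz \<Rightarrow> real^'nu^'nu \<Rightarrow> real^'nz
    \<Rightarrow> (nat \<Rightarrow> real^'nz) \<Rightarrow> nat \<Rightarrow> nat \<Rightarrow> (real^'nz, real^'nu) policy \<Rightarrow> real" where
  "regret f Qz R z1 r T W \<pi> =
     tracking_cost f Qz R z1 r T (policy_controls f z1 r T W \<pi>) - optimal_cost f Qz R z1 r T"

text \<open>The policy acts on the states \<open>z\<^sub>t\<close> of the nonlinear system; the lifted regret evaluates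
  the lifted cost at the control sequence generated there.\<close>

definition lifted_regret ::
  "(real^'nz \<Rightarrow> real^'nu \<Rightarrow> real^'nz) \<Rightarrow> real^'nx^'nx \<Rightarrow> real^'nu^'nx \<Rightarrow> real^'nx^'nz
    \<Rightarrow> (real^'nz \<Rightarrow> real^'nx) \<Rightarrow> real^'nz^'nz \<Rightarrow> real^'nu^'nu \<Rightarrow> real^'nz \<Rightarrow> real^'nx
    \<Rightarrow> (nat \<Rightarrow> real^'nz) \<Rightarrow> nat \<Rightarrow> nat \<Rightarrow> (real^'nz, real^'nu) policy \<Rightarrow> real" where
  "lifted_regret f A B C \<psi> Qz R z1 x1 r T W \<pi> =
     (let Q = transpose C ** Qz ** C; g = (\<lambda>t. \<psi> (r t)) in
        tracking_cost (linear_system A B) Q R x1 g T (policy_controls f z1 r T W \<pi>)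
        - optimal_cost (linear_system A B) Q R x1 g T)"

lemma posdef_coercive:
  fixes R :: "real^'n^'n"
  assumes "posdef R"
  obtains c where "0 < c" "\<And>x. c * (norm x)\<^sup>2 \<le> sqnorm_wrt R x"
proof -
  have cont: "continuous_on S (\<lambda>x. sqnorm_wrt R x)" for S
    unfolding sqnorm_wrt_def by (intro continuous_intros)
  obtain e :: "real^'n" where e: "norm e = 1"
    using vector_choose_size[of 1] by auto
  obtain y where y: "y \<in> sphere (0::real^'n) 1"
      and le: "\<And>x. x \<in> sphere 0 1 \<Longrightarrow> sqnorm_wrt R y \<le> sqnorm_wrt R x"
    using continuous_attains_inf[OF compact_sphere _ cont, of "0::real^'n" 1] e by auto
  show thesis
  proof
    show "0 < sqnorm_wrt R y"
    proof -
      have "y \<noteq> 0" using y by auto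
      then show ?thesis using assms by (simp add: sqnorm_wrt_def posdef_def)
    qed
  next
    fix x :: "real^'n"
    show "sqnorm_wrt R y * (norm x)\<^sup>2 \<le> sqnorm_wrt R x"
    proof (cases "x = 0")
      case False
      have "sqnorm_wrt R y \<le> sqnorm_wrt R ((1 / norm x) *\<^sub>R x)"
        by (rule le) (use False in simp)
      also have "\<dots> = sqnorm_wrt R x / (norm x)\<^sup>2"
        by (simp add: sqnorm_wrt_def matrix_vector_mult_scaleR power2_eq_square)
      finally show ?thesis using False by (simp add: field_simps)
    qed (simp add: sqnorm_wrt_def)
  qed
qed

lemma tracking_cost_attains_min:
  fixes F :: "real^'n \<Rightarrow> real^'nu \<Rightarrow> real^'n"
  assumes P: "psd P" and R: "posdef R"
    and cont: "\<And>t. continuous_on UNIV (\<lambda>u. trajectory F x1 u t)"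
  shows "\<exists>u. tracking_cost F P R x1 g T u = optimal_cost F P R x1 g T"
proof -
  let ?J = "tracking_cost F P R x1 g T"
  obtain c where c: "0 < c" "\<And>x. c * (norm x)\<^sup>2 \<le> sqnorm_wrt R x"
    using posdef_coercive[OF R] by blast
  have Pn: "0 \<le> sqnorm_wrt P x" for x
    using P by (simp add: psd_def sqnorm_wrt_def)
  have Rn: "0 \<le> sqnorm_wrt R x" for x
    using c(2)[of x] c(1) by (meson mult_nonneg_nonneg less_imp_le order_trans zero_le_power2)
  define M where "M = sqrt (?J (\<lambda>_. 0) / c)"
  define K where "K = (\<Pi>\<^sub>E t\<in>(UNIV::nat set). cball (0::real^'nu) M)"
  have J0: "0 \<le> ?J u" for u
    unfolding tracking_cost_def by (intro sum_nonneg add_nonneg_nonneg Pn Rn)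
  have M0: "0 \<le> M" using J0 c by (simp add: M_def)
  have "compactin (product_topology (\<lambda>t::nat. euclidean) UNIV) K"
    unfolding K_def by (subst compactin_PiE) auto
  then have "compact K"
    by (simp add: euclidean_product_topology)
  moreover have "(\<lambda>_. 0) \<in> K" using M0 by (auto simp: K_def)
  moreover have "continuous_on K ?J"
    unfolding tracking_cost_def sqnorm_wrt_def
    by (intro continuous_intros continuous_on_subset[OF cont]
        matrix_vector_mult_linear_continuous_on[THEN continuous_on_compose2]
        continuous_on_subset[OF continuous_on_product_coordinates]) auto
  ultimately obtain v where v: "v \<in> K" "\<And>u. u \<in> K \<Longrightarrow> ?J v \<le> ?J u"
    using continuous_attains_inf[of K ?J] by blast
  have min: "?J v \<le> ?J u" for u
  proof (cases "\<exists>t\<in>{1..T}. M < norm (u t)")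
    case True
    then obtain t where t: "t \<in> {1..T}" "M < norm (u t)" by blast
    have "?J v \<le> ?J (\<lambda>_. 0)" using v \<open>(\<lambda>_. 0) \<in> K\<close> by blast
    also have "\<dots> = c * M\<^sup>2" using J0 c by (simp add: M_def)
    also have "\<dots> \<le> c * (norm (u t))\<^sup>2"
      using t M0 c by (intro mult_left_mono power_mono) auto
    also have "\<dots> \<le> sqnorm_wrt R (u t)" by (rule c)
    also have "\<dots> \<le> sqnorm_wrt P (trajectory F x1 u t - g t) + sqnorm_wrt R (u t)"
      using Pn by simp
    also have "\<dots> \<le> ?J u"
      unfolding tracking_cost_def using t
      by (intro member_le_sum add_nonneg_nonneg Pn Rn) auto
    finally show ?thesis .
  next
    case False
    define w where "w = (\<lambda>t. if t \<in> {1..T} then u t else 0)"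
    have "w \<in> K" using False M0 by (auto simp: w_def K_def not_less)
    have traj: "t \<le> T \<Longrightarrow> trajectory F x1 w t = trajectory F x1 u t" for t
      by (induction t) (auto simp: w_def)
    have "?J w = ?J u"
      unfolding tracking_cost_def by (intro sum.cong refl) (simp add: traj, simp add: w_def)
    then show ?thesis using v(2)[OF \<open>w \<in> K\<close>] by simp
  qed
  have "optimal_cost F P R x1 g T = ?J v"
    unfolding optimal_cost_def by (rule cInf_eq_minimum) (use min in auto)
  then show ?thesis by metis
qed

lemma continuous_linear_trajectory:
  "continuous_on UNIV (\<lambda>u. trajectory (linear_system A B) x1 u t)"
proof (induction t)
  case (Suc t)
  have "continuous_on UNIV (\<lambda>u::nat \<Rightarrow> _. u t)"
    by (rule continuous_on_product_coordinates)
  then show ?case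
    using Suc
    by (cases "t = 0")
       (auto simp: linear_system_def
         intro!: continuous_on_add matrix_vector_mult_linear_continuous_on[THEN continuous_on_compose2])
qed simp

lemma tracking_cost_min_attained:
  assumes K: "koopman_embedding f A B C \<psi>" and "psd Qz" "posdef R"
  shows "\<exists>u. tracking_cost f Qz R z1 r T u = optimal_cost f Qz R z1 r T"
proof (rule tracking_cost_attains_min)
  fix t
  have "\<psi> (trajectory f z1 u t) = trajectory (linear_system A B) (\<psi> z1) u t" for u
    by (induction t) (use K in \<open>simp_all add: koopman_embedding_def linear_system_def\<close>)
  then have "trajectory f z1 u t = C *v trajectory (linear_system A B) (\<psi> z1) u t" for u
    using K unfolding koopman_embedding_def by metis
  then show "continuous_on UNIV (\<lambda>u. trajectory f z1 u t)"
    by (auto intro!: matrix_vector_mult_linear_continuous_on[THEN continuous_on_compose2]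
        continuous_linear_trajectory)
qed (use assms in auto)

lemma lifted_cost_min_attained:
  assumes Qz: "psd Qz" and "posdef R"
  shows "\<exists>u. tracking_cost (linear_system A B) (transpose C ** Qz ** C) R x1 g T u =
    optimal_cost (linear_system A B) (transpose C ** Qz ** C) R x1 g T"
proof (rule tracking_cost_attains_min)
  have "x \<bullet> ((transpose C ** Qz ** C) *v x) = (C *v x) \<bullet> (Qz *v (C *v x))" for x
    by (metis dot_lmul_matrix matrix_vector_mul_assoc
        transpose_matrix_vector inner_commute)
  then show "psd (transpose C ** Qz ** C)"
    using Qz by (simp add: psd_def matrix_transpose_mul matrix_mul_assoc)
qed (use assms continuous_linear_trajectory in auto)

end

theory Submission
  imports Defs
begin

text \<open>Along any control sequence, \<open>\<psi>\<close> maps the nonlinear trajectory from \<open>z1\<close> onto the lifted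
  trajectory from \<open>\<psi> z1\<close>. Since \<open>C\<close> is a left inverse of \<open>\<psi>\<close>, the matrix \<open>C\<close> sends the lifted
  tracking error \<open>\<psi> z\<^sub>t - \<psi> r\<^sub>t\<close> to \<open>z\<^sub>t - r\<^sub>t\<close>, and the weight \<open>C\<^sup>T Q\<^sub>z C\<close> measures an
  error by its image under \<open>C\<close>. Hence the two costs are the same function of the control sequence
  (\<open>lifted_tracking_cost_eq\<close>). So their infima agree, and so do their values at the controls that
  the policy generates.\<close>

lemma sqnorm_wrt_congruence:
  fixes P :: "real^'m^'m" and C :: "real^'n^'m"
  shows "sqnorm_wrt (transpose C ** P ** C) x = sqnorm_wrt P (C *v x)"
  unfolding sqnorm_wrt_def
  by (metis dot_lmul_matrix matrix_vector_mul_assoc transpose_matrix_vector inner_commute)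

lemma koopman_lifts_trajectory:
  assumes "koopman_embedding f A B C \<psi>"
  shows "trajectory (linear_system A B) (\<psi> z1) u t = \<psi> (trajectory f z1 u t)"
  using assms by (induction t) (simp_all add: koopman_embedding_def linear_system_def)

text \<open>The equality holds for every control sequence, not just for the closed-loop one. This is what
  allows the optimal costs to be compared.\<close>

lemma lifted_tracking_cost_eq:
  assumes "koopman_embedding f A B C \<psi>"
  shows "tracking_cost (linear_system A B) (transpose C ** P ** C) R (\<psi> z1) (\<lambda>t. \<psi> (r t)) T u
    = tracking_cost f P R z1 r T u"
proof -
  have "C *v \<psi> z = z" for z
    using assms unfolding koopman_embedding_def by metis
  then show ?thesis
    by (simp add: tracking_cost_def koopman_lifts_trajectory[OF assms] sqnorm_wrt_congruence
        matrix_vector_mult_diff_distrib)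
qed

theorem corollary3p1:
  fixes f :: "real^'nz \<Rightarrow> real^'nu \<Rightarrow> real^'nz"
    and A :: "real^'nx^'nx" and B :: "real^'nu^'nx" and C :: "real^'nx^'nz"
    and \<psi> :: "real^'nz \<Rightarrow> real^'nx"
    and Qz :: "real^'nz^'nz" and R :: "real^'nu^'nu"
    and z1 :: "real^'nz" and x1 :: "real^'nx"
    and r :: "nat \<Rightarrow> real^'nz" and T W :: nat
    and \<pi> :: "(real^'nz, real^'nu) policy"
  assumes "psd Qz" and "posdef R"
    and "\<And>t. t \<in> {1..T} \<Longrightarrow> norm (r t) \<le> 1"
    and "koopman_embedding f A B C \<psi>"
    and "x1 = \<psi> z1"
  shows "regret f Qz R z1 r T W \<pi> = lifted_regret f A B C \<psi> Qz R z1 x1 r T W \<pi>"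
  by (simp add: regret_def lifted_regret_def optimal_cost_def \<open>x1 = \<psi> z1\<close>
      lifted_tracking_cost_eq[OF \<open>koopman_embedding f A B C \<psi>\<close>])

end
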